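(* Let $n\geq 1$ be an integer and let $D(n+1)$ denote the diameter of $ST_{n+1}$. For $2\leq i\leq n+1$ let $C_i$ be the set of vertices $\sigma_1\sigma_2\ldots\sigma_{n+1}$ of $ST_{n+1}$ with $\sigma_1=i$, and for $\omega\geq 0$ let $V^i_\omega(n+1)$ be the set of vertices of $C_i$ whose weight in $ST_{n+1}$ is $\omega$. Then, for every $i$ with $2\leq i\leq n+1$: (1) $|V_0^i(n+1)|=0$; (2) $|V_\omega^i(n+1)|=|V_{\omega-1}(n)|$ for $\omega=1,2,\ldots,2\lfloor\frac{D(n+1)}{2}\rfloor$; (3) if $n$ is even, then $|V^i_{D(n+1)}(n+1)|=0$.
   Context: For an integer $m>1$, the star graph $ST_m$ is the Cayley graph of the symmetric group $S_m$ with generating set $\{(1\;j): j=2,\ldots,m\}$: its vertices are the permutations $\sigma_1\sigma_2\ldots\sigma_m$ of $\{1,\ldots,m\}$ (with $\sigma_j$ the image of $j$), and two vertices are adjacent iff one is obtained from the other by swapping the entries in positions $1$ and $j$ for some $j\in\{2,\ldots,m\}$ (for $m=1$, $ST_1$ is the single vertex $1$). The weight of a vertex is its graph distance to the identity permutation $12\ldots m$. For $\omega\geq 0$, $V_\omega(n)$ denotes the set of vertices of $ST_n$ of weight $\omega$. *)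

theory Defs
  imports "Graph_Theory.Graph_Theory" "HOL-Combinatorics.Permutations"
begin

text \<open>If \<open>v\<close> is not reachable from \<open>u\<close>, the value of \<open>graph_dist G u v\<close> is
  unspecified; star graphs are connected (\<open>star_graph_connected\<close> below), so this case does
  not arise for them.\<close>

definition graph_dist :: "('a, 'b) pre_digraph \<Rightarrow> 'a \<Rightarrow> 'a \<Rightarrow> nat" where
  "graph_dist G u v = (LEAST k. \<exists>p. pre_digraph.awalk G u p v \<and> length p = k)"

definition graph_diameter :: "('a, 'b) pre_digraph \<Rightarrow> nat" where
  "graph_diameter G = Max {graph_dist G u v | u v. u \<in> verts G \<and> v \<in> verts G}"

text \<open>Precomposing with \<open>transpose 1 j\<close> swaps the entries in positions \<open>1\<close> and \<open>j\<close> of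
  the word \<open>\<sigma> 1, \<dots>, \<sigma> m\<close>. An undirected edge is a pair of opposite arcs.\<close>

definition star_graph :: "nat \<Rightarrow> (nat \<Rightarrow> nat) pair_pre_digraph" where
  "star_graph m =
     \<lparr> pverts = {\<sigma>. \<sigma> permutes {1..m}},
       parcs = {(\<sigma>, \<sigma> \<circ> transpose 1 j) | \<sigma> j. \<sigma> permutes {1..m} \<and> j \<in> {2..m}} \<rparr>"

definition star_diameter :: "nat \<Rightarrow> nat" where
  "star_diameter m = graph_diameter (with_proj (star_graph m))"

definition star_weight :: "nat \<Rightarrow> (nat \<Rightarrow> nat) \<Rightarrow> nat" where
  "star_weight m \<sigma> = graph_dist (with_proj (star_graph m)) \<sigma> id"

definition star_V :: "nat \<Rightarrow> nat \<Rightarrow> (nat \<Rightarrow> nat) set" where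
  "star_V m \<omega> = {\<sigma> \<in> pverts (star_graph m). star_weight m \<sigma> = \<omega>}"

definition star_C :: "nat \<Rightarrow> nat \<Rightarrow> (nat \<Rightarrow> nat) set" where
  "star_C m i = {\<sigma> \<in> pverts (star_graph m). \<sigma> 1 = i}"

definition star_VC :: "nat \<Rightarrow> nat \<Rightarrow> nat \<Rightarrow> (nat \<Rightarrow> nat) set" where
  "star_VC m i \<omega> = {\<sigma> \<in> star_C m i. star_weight m \<sigma> = \<omega>}"

lemma star_graph_pair_graph: "pair_graph (star_graph m)"
proof
  let ?P = "{\<sigma>::nat \<Rightarrow> nat. \<sigma> permutes {1..m}}"
  have fin: "finite ?P" by (simp add: finite_permutations)
  have perm: "\<sigma> \<circ> transpose 1 j permutes {1..m}" if "\<sigma> permutes {1..m}" "j \<in> {2..m}" for \<sigma> j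
    using that by (intro permutes_compose permutes_swap_id) auto
  have ne: "\<sigma> \<noteq> \<sigma> \<circ> transpose 1 j" if "\<sigma> permutes {1..m}" "j \<in> {2..m}" for \<sigma> :: "nat \<Rightarrow> nat" and j
  proof
    assume "\<sigma> = \<sigma> \<circ> transpose 1 j"
    then have "\<sigma> 1 = (\<sigma> \<circ> transpose 1 j) 1" by (rule fun_cong)
    then have "\<sigma> 1 = \<sigma> j" by simp
    with permutes_inj[OF that(1)] have "1 = j" by (rule injD)
    with that(2) show False by simp
  qed
  have sub: "parcs (star_graph m) \<subseteq> ?P \<times> ?P"
    using perm by (auto simp: star_graph_def)
  show "finite (pverts (star_graph m))" using fin by (simp add: star_graph_def)
  show "finite (parcs (star_graph m))" using sub fin by (meson finite_SigmaI finite_subset)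
  fix e assume e: "e \<in> parcs (star_graph m)"
  show "fst e \<in> pverts (star_graph m)" "snd e \<in> pverts (star_graph m)"
    using subsetD[OF sub e] by (auto simp: star_graph_def)
  show "fst e \<noteq> snd e" using e ne by (fastforce simp: star_graph_def)
next
  have "(\<sigma> \<circ> transpose 1 j, \<sigma>) \<in> parcs (star_graph m)"
    if "\<sigma> permutes {1..m}" "j \<in> {2..m}" for \<sigma> j
  proof -
    have "\<sigma> \<circ> transpose 1 j permutes {1..m}"
      using that by (intro permutes_compose permutes_swap_id) auto
    moreover have "\<sigma> = (\<sigma> \<circ> transpose 1 j) \<circ> transpose 1 j" by (simp add: comp_assoc)
    ultimately show ?thesis using that(2) unfolding star_graph_def by auto
  qed
  then show "symmetric (with_proj (star_graph m))"
    by (auto simp: symmetric_def sym_def star_graph_def)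
qed

lemma star_graph_connected:
  assumes "\<sigma> permutes {1..m}"
  shows "\<sigma> \<rightarrow>\<^sup>*\<^bsub>with_proj (star_graph m)\<^esub> id"
proof -
  interpret pair_graph "star_graph m" by (rule star_graph_pair_graph)
  let ?R = "\<lambda>\<sigma> \<tau>. \<sigma> \<rightarrow>\<^sup>*\<^bsub>with_proj (star_graph m)\<^esub> \<tau>"
  have vert: "\<sigma> \<in> pverts (star_graph m) \<longleftrightarrow> \<sigma> permutes {1..m}" for \<sigma>
    by (simp add: star_graph_def)
  have one: "?R \<sigma> (\<sigma> \<circ> transpose 1 j)" if "\<sigma> permutes {1..m}" "j \<in> {1..m}" for \<sigma> j
  proof (cases "j = 1")
    case True
    then show ?thesis using that by (simp add: vert)
  next
    case False
    then have "(\<sigma>, \<sigma> \<circ> transpose 1 j) \<in> parcs (star_graph m)"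
      using that by (auto simp: star_graph_def)
    then show ?thesis by auto
  qed
  have perm: "\<sigma> \<circ> transpose a b permutes {1..m}"
    if "\<sigma> permutes {1..m}" "a \<in> {1..m}" "b \<in> {1..m}" for \<sigma> a b
    using that by (intro permutes_compose permutes_swap_id) auto
  have two: "?R \<sigma> (\<sigma> \<circ> transpose a b)"
    if \<sigma>: "\<sigma> permutes {1..m}" and ab: "a \<in> {1..m}" "b \<in> {1..m}" "a \<noteq> b" for \<sigma> a b
  proof (cases "a = 1 \<or> b = 1")
    case True
    then show ?thesis using one \<sigma> ab by (auto simp: transpose_commute)
  next
    case False
    have 1: "1 \<in> {1..m}" using ab by auto
    have "transpose a b = transpose 1 a \<circ> transpose 1 b \<circ> transpose 1 a"
      using False ab by (auto simp: fun_eq_iff transpose_def)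
    then have eq: "\<sigma> \<circ> transpose a b = \<sigma> \<circ> transpose 1 a \<circ> transpose 1 b \<circ> transpose 1 a"
      by (simp add: comp_assoc)
    show ?thesis unfolding eq
      using one[OF \<sigma> ab(1)] one[OF perm[OF \<sigma> 1 ab(1)] ab(2)]
        one[OF perm[OF perm[OF \<sigma> 1 ab(1)] 1 ab(2)] ab(1)]
      by (meson reachable_trans)
  qed
  have "?R id \<sigma>"
    using finite_atLeastAtMost assms
  proof (induction rule: permutes_rev_induct)
    case id
    show ?case by (rule reachable_refl) (simp only: vert permutes_id)
  next
    case (swap a b p)
    then show ?case using two by (meson reachable_trans)
  qed
  then show ?thesis by (rule symmetric_reachable')
qed

end

theory Submission
  imports Defs
begin

text \<open>The weight of \<open>\<sigma>\<close> is \<open>2 * M - T\<close>, where \<open>M\<close> counts the points other than \<open>1\<close> moved by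
  \<open>\<sigma>\<close> and \<open>T\<close> is the least number of transpositions whose product is \<open>\<sigma>\<close>; in particular it
  does not depend on \<open>m\<close>. If \<open>\<sigma> 1 = i \<noteq> 1\<close>, composing with \<open>transpose 1 i\<close> sends the symbol
  \<open>i\<close> home: \<open>M\<close> and \<open>T\<close> both drop by one, hence so does the weight. The resulting
  permutation fixes \<open>i\<close>, so after relabelling it is a vertex of \<open>ST\<^sub>n\<close>, and all vertices of
  \<open>ST\<^sub>n\<close> arise. As \<open>M \<le> 2 * T\<close>, weights in \<open>ST\<^sub>n\<close> are at most \<open>3 * (n - 1) / 2\<close>,
  whereas for even \<open>n\<close> the product of the transpositions \<open>(2 3), (4 5), \<dots>, (n n+1)\<close> has
  weight \<open>3 * n / 2\<close> in \<open>ST\<^sub>n\<^sub>+\<^sub>1\<close>; this gives the third claim.\<close>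

section \<open>Least number of transpositions in a product\<close>

definition transp_length :: "('a \<Rightarrow> 'a) \<Rightarrow> nat" where
  "transp_length p = (LEAST k. swapidseq k p)"

lemma swapidseq_transp_length: "permutation p \<Longrightarrow> swapidseq (transp_length p) p"
  unfolding transp_length_def permutation_def by (rule LeastI_ex)

lemma transp_length_le: "swapidseq k p \<Longrightarrow> transp_length p \<le> k"
  unfolding transp_length_def by (rule Least_le)

lemma transp_length_id [simp]: "transp_length id = 0"
  using transp_length_le[of 0 id] by simp

lemma permutation_comp_transpose:
  "permutation p \<Longrightarrow> permutation (p \<circ> transpose a b)"
  by (intro permutation_compose permutation_swap_id)

lemma transp_length_comp_transpose_le:
  assumes "permutation p" and "a \<noteq> b"
  shows "transp_length (p \<circ> transpose a b) \<le> Suc (transp_length p)"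
  using assms by (intro transp_length_le swapidseq_endswap swapidseq_transp_length)

text \<open>The product fixes \<open>b\<close>: the swap splits \<open>b\<close> off its cycle, and
  a shortest word for \<open>p\<close> can then be shortened.\<close>

lemma transp_length_comp_transpose_less:
  assumes p: "permutation p" and ab: "p a = b" "a \<noteq> b"
  shows "Suc (transp_length (p \<circ> transpose a b)) \<le> transp_length p"
proof -
  have inj: "inj p"
    using permutation_bijective[OF p] by (rule bij_is_inj)
  have ne: "b \<noteq> p b"
    using inj ab by (metis injD)
  \<comment> \<open>A swap of two positions is turned into a swap of two values, because
    \<open>fixing_swapidseq_decrease\<close> multiplies from the left.\<close>
  have eq: "p \<circ> transpose a b = transpose b (p b) \<circ> p"
    using inj ab by (auto simp: fun_eq_iff transpose_def dest: injD)
  have "transp_length p \<noteq> 0 \<and> swapidseq (transp_length p - 1) (transpose b (p b) \<circ> p)"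
    by (rule fixing_swapidseq_decrease[OF swapidseq_transp_length[OF p] ne]) simp
  then show ?thesis
    unfolding eq using transp_length_le by fastforce
qed

text \<open>Conjugation acts factor by factor and turns each transposition into the one of the
  relabelled points.\<close>

lemma swapidseq_conj:
  assumes "swapidseq k p"
  shows "swapidseq k (transpose c d \<circ> p \<circ> transpose c d)"
  using assms
proof (induction rule: swapidseq.induct)
  case id
  have "transpose c d \<circ> id \<circ> transpose c d = id"
    by (simp add: fun_eq_iff)
  then show ?case by (metis swapidseq.id)
next
  case (comp_Suc k p a b)
  let ?g = "transpose c d"
  have "?g \<circ> transpose a b = transpose (?g a) (?g b) \<circ> ?g"
    by (auto simp: fun_eq_iff transpose_def)
  then have "?g \<circ> (transpose a b \<circ> p) \<circ> ?g = transpose (?g a) (?g b) \<circ> (?g \<circ> p \<circ> ?g)"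
    by (metis comp_assoc)
  moreover have "?g a \<noteq> ?g b"
    using comp_Suc.hyps by (metis transpose_involutory)
  ultimately show ?case
    using swapidseq.comp_Suc[OF comp_Suc.IH] by metis
qed

lemma conj_transpose_twice:
  "transpose c d \<circ> (transpose c d \<circ> p \<circ> transpose c d) \<circ> transpose c d = p"
  by (simp add: fun_eq_iff)

lemma transp_length_conj:
  assumes "permutation p"
  shows "transp_length (transpose c d \<circ> p \<circ> transpose c d) = transp_length p"
proof -
  have "swapidseq k (transpose c d \<circ> p \<circ> transpose c d) \<longleftrightarrow> swapidseq k p" for k
    using swapidseq_conj[of k p c d]
      swapidseq_conj[of k "transpose c d \<circ> p \<circ> transpose c d" c d]
    unfolding conj_transpose_twice by blast
  then show ?thesis
    unfolding transp_length_def by simp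
qed

section \<open>Moved points and the effect of one swap\<close>

lemma card_support_le:
  assumes "swapidseq k p"
  shows "finite {x. p x \<noteq> x} \<and> card {x. p x \<noteq> x} \<le> 2 * k"
  using assms
proof (induction rule: swapidseq.induct)
  case id
  show ?case by simp
next
  case (comp_Suc k p a b)
  have sub: "{x. (transpose a b \<circ> p) x \<noteq> x} \<subseteq> {a, b} \<union> {x. p x \<noteq> x}"
    by (auto simp: transpose_def)
  have fin: "finite ({a, b} \<union> {x. p x \<noteq> x})"
    using comp_Suc.IH by simp
  have "card ({a, b} \<union> {x. p x \<noteq> x}) \<le> card {a, b} + card {x. p x \<noteq> x}"
    by (rule card_Un_le)
  also have "\<dots> \<le> 2 * Suc k"
    using comp_Suc.IH comp_Suc.hyps by simp
  finally show ?case
    using card_mono[OF fin sub] finite_subset[OF sub fin] by linarith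
qed

text \<open>Omitting \<open>1\<close> absorbs a case distinction: the usual distance formula, moved
  points plus nontrivial cycles, minus 2 if \<open>1\<close> is moved, becomes 2 * M - T.\<close>

definition moved :: "(nat \<Rightarrow> nat) \<Rightarrow> nat set" where
  "moved p = {x. x \<noteq> 1 \<and> p x \<noteq> x}"

lemma moved_le_transp_length:
  assumes "permutation p"
  shows finite_moved: "finite (moved p)"
    and card_moved_le: "card (moved p) \<le> 2 * transp_length p"
proof -
  have sub: "moved p \<subseteq> {x. p x \<noteq> x}"
    by (auto simp: moved_def)
  note supp = card_support_le[OF swapidseq_transp_length[OF assms]]
  show "finite (moved p)"
    using supp sub by (meson finite_subset)
  show "card (moved p) \<le> 2 * transp_length p"
    using supp card_mono[OF _ sub] by linarith
qed

lemma moved_eq_empty: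
  assumes "permutation p" and "moved p = {}"
  shows "p = id"
proof -
  have *: "p x = x" if "x \<noteq> 1" for x
    using assms(2) that by (auto simp: moved_def)
  have "p 1 = 1"
    using * permutation_bijective[OF assms(1)] by (metis bij_is_inj injD)
  with * have "p x = id x" for x
    by (cases "x = 1") simp_all
  then show ?thesis
    by (rule ext)
qed

text \<open>The swap puts \<open>j\<close> at its own position, and the symbol displaced from there
  lands at position \<open>1\<close>, which \<open>moved\<close> does not count.\<close>

lemma moved_comp_home:
  assumes "permutation p" and "p 1 = j" and "j \<noteq> 1"
  shows "card (moved p) = Suc (card (moved (p \<circ> transpose 1 j)))"
proof -
  have inj: "inj p"
    using permutation_bijective[OF assms(1)] by (rule bij_is_inj)
  have "p j \<noteq> j"
    using inj assms(2,3) by (metis injD)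
  then have "moved p = insert j (moved (p \<circ> transpose 1 j))"
    using assms(2,3) by (auto simp: moved_def transpose_def split: if_splits)
  moreover have "j \<notin> moved (p \<circ> transpose 1 j)"
    using assms(2) by (simp add: moved_def)
  ultimately show ?thesis
    using finite_moved[OF permutation_comp_transpose[OF assms(1)], of 1 j] by simp
qed

lemma transp_length_comp_home:
  assumes "permutation p" and "p a = b" and "a \<noteq> b"
  shows "transp_length p = Suc (transp_length (p \<circ> transpose a b))"
proof -
  have "p = (p \<circ> transpose a b) \<circ> transpose a b"
    by (simp add: comp_assoc)
  then have "transp_length p \<le> Suc (transp_length (p \<circ> transpose a b))"
    using transp_length_comp_transpose_le[OF permutation_comp_transpose[OF assms(1), of a b] assms(3)]
    by simp
  with transp_length_comp_transpose_less[OF assms] show ?thesis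
    by simp
qed

text \<open>A swap lowers 2 * M - T by at most one: if it does not send a symbol home, no moved
  point becomes fixed and T grows by at most one. The additive form avoids truncated
  subtraction.\<close>

lemma swap_step_lower:
  assumes p: "permutation p" and j: "j \<noteq> 1"
  shows "2 * card (moved p) + transp_length (p \<circ> transpose 1 j)
    \<le> Suc (2 * card (moved (p \<circ> transpose 1 j)) + transp_length p)"
proof (cases "p 1 = j")
  case True
  then show ?thesis
    using moved_comp_home[OF p True j] transp_length_comp_home[OF p True] j by simp
next
  case False
  have "moved p \<subseteq> moved (p \<circ> transpose 1 j)"
    using False by (auto simp: moved_def transpose_def)
  then have "card (moved p) \<le> card (moved (p \<circ> transpose 1 j))"
    by (intro card_mono finite_moved permutation_comp_transpose p)
  then show ?thesis
    using transp_length_comp_transpose_le[OF p, of 1 j] j by linarith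
qed

section \<open>Walks to the identity and the weight formula\<close>

lemma permutes_permutation: "p permutes {1..m::nat} \<Longrightarrow> permutation p"
  by (metis finite_atLeastAtMost permutation_permutes)

lemma moved_subset: "p permutes {1..m} \<Longrightarrow> moved p \<subseteq> {2..m}"
proof
  fix x
  assume p: "p permutes {1..m}" and "x \<in> moved p"
  then have "x \<noteq> 1" "x \<in> {1..m}"
    using permutes_not_in[OF p, of x] unfolding moved_def by blast+
  then show "x \<in> {2..m}" by simp
qed

lemma star_permutes_step:
  assumes "p permutes {1..m::nat}" and "j \<in> {2..m}"
  shows "p \<circ> transpose 1 j permutes {1..m}"
  using assms by (intro permutes_compose permutes_swap_id) auto

abbreviation star_walk :: "nat \<Rightarrow> (nat \<Rightarrow> nat) \<Rightarrow> ((nat \<Rightarrow> nat) \<times> (nat \<Rightarrow> nat)) list \<Rightarrow> (nat \<Rightarrow> nat) \<Rightarrow> bool" where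
  "star_walk m \<equiv> pre_digraph.awalk (with_proj (star_graph m))"

lemma star_walk_Nil: "star_walk m p [] q \<longleftrightarrow> p = q \<and> p permutes {1..m}"
proof -
  interpret pair_graph "star_graph m" by (rule star_graph_pair_graph)
  show ?thesis
    unfolding awalk_Nil_iff by (simp add: star_graph_def)
qed

lemma star_walk_Cons:
  "star_walk m p (e # w) q \<longleftrightarrow> (\<exists>j\<in>{2..m}. e = (p, p \<circ> transpose 1 j) \<and>
     p permutes {1..m} \<and> star_walk m (p \<circ> transpose 1 j) w q)"
proof -
  interpret pair_graph "star_graph m" by (rule star_graph_pair_graph)
  have "star_walk m p (e # w) q \<longleftrightarrow>
      e \<in> parcs (star_graph m) \<and> p = fst e \<and> star_walk m (snd e) w q"
    unfolding awalk_Cons_iff by simp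
  moreover have "e \<in> parcs (star_graph m) \<longleftrightarrow>
      (\<exists>j\<in>{2..m}. e = (fst e, fst e \<circ> transpose 1 j) \<and> fst e permutes {1..m})"
    unfolding star_graph_def by (cases e) auto
  ultimately show ?thesis
    by (metis fst_conv snd_conv)
qed

lemma star_walk_lower:
  assumes "star_walk m p w id"
  shows "2 * card (moved p) \<le> length w + transp_length p"
  using assms
proof (induction w arbitrary: p)
  case Nil
  then have "p = id" unfolding star_walk_Nil by blast
  then show ?case by (simp add: moved_def)
next
  case (Cons e w)
  from Cons.prems obtain j where p: "p permutes {1..m}" and j: "j \<in> {2..m}"
    and w: "star_walk m (p \<circ> transpose 1 j) w id"
    unfolding star_walk_Cons by blast
  have "j \<noteq> 1" using j by simp
  then show ?case
    using Cons.IH[OF w] swap_step_lower[OF permutes_permutation[OF p], of j] length_Cons[of e w]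
    by linarith
qed

lemma star_walk_step:
  assumes "star_walk m (p \<circ> transpose 1 j) w id" and "p permutes {1..m}" and "j \<in> {2..m}"
  shows "star_walk m p ((p, p \<circ> transpose 1 j) # w) id"
  using assms unfolding star_walk_Cons by blast

text \<open>Greedy routing: a symbol other than \<open>1\<close> at position \<open>1\<close> is
  sent home; if \<open>1\<close> is there, it is swapped with any misplaced symbol. Each such step
  lowers 2 * M - T by exactly one.\<close>

lemma star_walk_upper:
  assumes "p permutes {1..m}"
  shows "\<exists>w. star_walk m p w id \<and> length w + transp_length p \<le> 2 * card (moved p)"
  using assms
\<comment> \<open>A swap with \<open>1\<close> in front keeps M but clears the extra 1 of the
  measure; sending a symbol home may restore that 1 but lowers 2 * M by two.\<close>
proof (induction "2 * card (moved p) + (if p 1 = 1 then 1 else 0)" arbitrary: p rule: less_induct)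
  case less
  note perm = permutes_permutation[OF less.prems]
  have inj: "inj p" using less.prems by (rule permutes_inj)
  consider (id) "p = id" | (home) "p 1 \<noteq> 1" | (enter) "p 1 = 1" "p \<noteq> id" by blast
  then show ?case
  proof cases
    case id
    have "star_walk m p [] id"
      unfolding star_walk_Nil using less.prems id by blast
    then show ?thesis
      using id by (intro exI[of _ "[]"]) (simp add: moved_def)
  next
    case home
    define j where "j = p 1"
    have "1 \<in> {1..m}"
      using home permutes_not_in[OF less.prems] by blast
    then have j: "j \<in> {2..m}"
      using home permutes_in_image[OF less.prems, of 1] unfolding j_def by auto
    let ?q = "p \<circ> transpose 1 j"
    have M: "card (moved p) = Suc (card (moved ?q))"
      using moved_comp_home[OF perm] home j_def by simp
    have T: "transp_length p = Suc (transp_length ?q)"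
      using transp_length_comp_home[OF perm] home j_def by metis
    have "2 * card (moved ?q) + (if ?q 1 = 1 then 1 else 0)
        < 2 * card (moved p) + (if p 1 = 1 then 1 else 0)"
      unfolding M by simp
    from less.hyps[OF this star_permutes_step[OF less.prems j]]
    obtain w where "star_walk m ?q w id" "length w + transp_length ?q \<le> 2 * card (moved ?q)"
      by blast
    then show ?thesis
      using star_walk_step[OF _ less.prems j] M T by (intro exI[of _ "(p, ?q) # w"]) simp
  next
    case enter
    then obtain j where j_moved: "j \<in> moved p"
      using moved_eq_empty[OF perm] by blast
    with moved_subset[OF less.prems] have j: "j \<in> {2..m}" by blast
    let ?q = "p \<circ> transpose 1 j"
    have M: "moved p = moved ?q"
      using enter(1) j_moved injD[OF inj, of 1] by (auto simp: moved_def transpose_def split: if_splits)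
    have "p j \<noteq> p 1"
      using j inj_eq[OF inj, of j 1] by simp
    then have q1: "?q 1 \<noteq> 1"
      using enter(1) by simp
    \<comment> \<open>Seen from \<open>?q\<close>, undoing the swap sends the symbol
      \<open>1\<close>, now at position \<open>j\<close>, home; so T has risen by one.\<close>
    have "transp_length ?q = Suc (transp_length (?q \<circ> transpose j 1))"
      using enter(1) j
      by (intro transp_length_comp_home permutation_comp_transpose perm) auto
    also have "?q \<circ> transpose j 1 = p"
      by (simp add: fun_eq_iff transpose_commute[of j])
    finally have T: "transp_length ?q = Suc (transp_length p)" .
    have "2 * card (moved ?q) + (if ?q 1 = 1 then 1 else 0)
        < 2 * card (moved p) + (if p 1 = 1 then 1 else 0)"
      unfolding M using enter(1) q1 by simp
    from less.hyps[OF this star_permutes_step[OF less.prems j]]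
    obtain w where "star_walk m ?q w id" "length w + transp_length ?q \<le> 2 * card (moved ?q)"
      by blast
    then show ?thesis
      using star_walk_step[OF _ less.prems j] M T by (intro exI[of _ "(p, ?q) # w"]) simp
  qed
qed

lemma star_weight_eq:
  assumes "p permutes {1..m}"
  shows "star_weight m p + transp_length p = 2 * card (moved p)"
proof -
  obtain w where w: "star_walk m p w id" "length w + transp_length p \<le> 2 * card (moved p)"
    using star_walk_upper[OF assms] by blast
  have "star_weight m p = length w"
    unfolding star_weight_def graph_dist_def
  proof (rule Least_equality)
    show "\<exists>v. star_walk m p v id \<and> length v = length w"
      using w(1) by blast
    show "length w \<le> k" if "\<exists>v. star_walk m p v id \<and> length v = k" for k
      using that w(2) star_walk_lower by fastforce
  qed
  then show ?thesis
    using star_walk_lower[OF w(1)] w(2) by simp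
qed

lemma star_weight_comp_home:
  assumes p: "p permutes {1..m}" and "p 1 = i" and "i \<in> {2..m}"
  shows "star_weight m p = Suc (star_weight m (p \<circ> transpose 1 i))"
  using star_weight_eq[OF p] star_weight_eq[OF star_permutes_step[OF p assms(3)]]
    moved_comp_home[OF permutes_permutation[OF p] assms(2)]
    transp_length_comp_home[OF permutes_permutation[OF p] assms(2)] assms(3)
  by simp

section \<open>Relabelling points other than 1\<close>

lemma card_moved_conj:
  assumes "c \<noteq> 1" and "d \<noteq> 1"
  shows "card (moved (transpose c d \<circ> p \<circ> transpose c d)) = card (moved p)"
proof -
  let ?g = "transpose c d"
  have fix1: "?g x = 1 \<longleftrightarrow> x = 1" for x
    using assms by (auto simp: transpose_def)
  have iff: "x \<in> moved (?g \<circ> p \<circ> ?g) \<longleftrightarrow> ?g x \<in> moved p" for x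
  proof -
    have "?g (p (?g x)) = x \<longleftrightarrow> p (?g x) = ?g x"
      by (metis transpose_involutory)
    then show ?thesis
      unfolding moved_def using fix1[of x] by simp
  qed
  have "moved (?g \<circ> p \<circ> ?g) = ?g ` moved p"
  proof (intro set_eqI iffI)
    fix x
    assume "x \<in> moved (?g \<circ> p \<circ> ?g)"
    then show "x \<in> ?g ` moved p"
      unfolding iff by (intro image_eqI[of _ _ "?g x"]) simp_all
  next
    fix x
    assume "x \<in> ?g ` moved p"
    then show "x \<in> moved (?g \<circ> p \<circ> ?g)"
      unfolding iff by auto
  qed
  then show ?thesis
    by (simp add: card_image)
qed

text \<open>Both M and T survive a relabelling that fixes \<open>1\<close>. The ranges
  \<open>m\<close> and \<open>k\<close> may differ, which carries weights from one star graph to a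
  smaller one.\<close>

lemma star_weight_conj:
  assumes p: "p permutes {1..m}" and q: "transpose c d \<circ> p \<circ> transpose c d permutes {1..k}"
    and "c \<noteq> 1" and "d \<noteq> 1"
  shows "star_weight k (transpose c d \<circ> p \<circ> transpose c d) = star_weight m p"
  using star_weight_eq[OF p] star_weight_eq[OF q] card_moved_conj[OF assms(3,4), of p]
    transp_length_conj[OF permutes_permutation[OF p], of c d] by simp

section \<open>Extremal weights and the diameter\<close>

lemma star_weight_le:
  assumes p: "p permutes {1..m}" and "m \<ge> 1"
  shows "2 * star_weight m p \<le> 3 * (m - 1)"
proof -
  have "card (moved p) \<le> m - 1"
    using card_mono[OF _ moved_subset[OF p]] by simp
  \<comment> \<open>From M <= 2 * T the doubled weight 4 * M - 2 * T is at most 3 * M.\<close>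
  then show ?thesis
    using star_weight_eq[OF p] card_moved_le[OF permutes_permutation[OF p]] by linarith
qed

text \<open>The witness (2 3)(4 5)...(2k 2k+1) avoids \<open>1\<close> and attains equality in M <=
  2 * T.\<close>

lemma exists_disjoint_transpositions:
  "\<exists>p. p permutes {2..<2 * k + 2} \<and> (\<forall>x\<in>{2..<2 * k + 2}. p x \<noteq> x) \<and> swapidseq k p"
proof (induction k)
  case 0
  show ?case by (intro exI[of _ id]) (simp del: id_apply)
next
  case (Suc k)
  then obtain p where p: "p permutes {2..<2 * k + 2}" "\<forall>x\<in>{2..<2 * k + 2}. p x \<noteq> x"
    "swapidseq k p" by blast
  let ?a = "2 * k + 2" and ?b = "2 * k + 3"
  let ?q = "transpose ?a ?b \<circ> p"
  have "p permutes {2..<2 * Suc k + 2}"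
    using p(1) by (rule permutes_subset) auto
  then have "?q permutes {2..<2 * Suc k + 2}"
    by (intro permutes_compose permutes_swap_id) auto
  moreover have "?q x \<noteq> x" if x: "x \<in> {2..<2 * Suc k + 2}" for x
  proof (cases "x \<in> {2..<2 * k + 2}")
    case True
    with p(1) have "p x \<in> {2..<2 * k + 2}" by (simp only: permutes_in_image)
    then have "?q x = p x" by (auto simp: transpose_def)
    with True p(2) show ?thesis by simp
  next
    case False
    then have "p x = x" by (rule permutes_not_in[OF p(1)])
    moreover have "x = ?a \<or> x = ?b" using False x by auto
    ultimately show ?thesis by auto
  qed
  moreover have "swapidseq (Suc k) ?q"
    using p(3) by (intro swapidseq.comp_Suc) simp_all
  ultimately show ?case by blast
qed

lemma star_weight_le_diameter:
  assumes "p permutes {1..m}"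
  shows "star_weight m p \<le> star_diameter m"
proof -
  let ?G = "with_proj (star_graph m)"
  let ?P = "{p::nat \<Rightarrow> nat. p permutes {1..m}}"
  \<comment> \<open>Writing the set of distances as an image of a finite product gives the
    finiteness that \<open>Max_ge\<close> requires.\<close>
  have "{graph_dist ?G u v | u v. u \<in> verts ?G \<and> v \<in> verts ?G}
      = (\<lambda>(u, v). graph_dist ?G u v) ` (?P \<times> ?P)"
    by (auto simp: star_graph_def)
  moreover have "finite (?P \<times> ?P)"
    by (simp add: finite_permutations)
  moreover have "(p, id) \<in> ?P \<times> ?P"
    using assms by (simp add: permutes_id)
  ultimately have "finite {graph_dist ?G u v | u v. u \<in> verts ?G \<and> v \<in> verts ?G}"
    and "graph_dist ?G p id \<in> {graph_dist ?G u v | u v. u \<in> verts ?G \<and> v \<in> verts ?G}"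
    by (simp, metis (mono_tags, lifting) case_prod_conv imageI)
  then show ?thesis
    unfolding star_weight_def star_diameter_def graph_diameter_def by (rule Max_ge)
qed

lemma star_diameter_ge:
  assumes "even n"
  shows "3 * n \<le> 2 * star_diameter (n + 1)"
proof -
  obtain k where n: "n = 2 * k" using assms by blast
  obtain p where p: "p permutes {2..<2 * k + 2}" "\<forall>x\<in>{2..<2 * k + 2}. p x \<noteq> x"
    "swapidseq k p" using exists_disjoint_transpositions by blast
  have perm: "p permutes {1..n + 1}"
    using p(1) by (rule permutes_subset) (auto simp: n)
  have "moved p = {2..<2 * k + 2}"
    using p(2) permutes_not_in[OF p(1)] by (fastforce simp: moved_def)
  \<comment> \<open>Here M = 2 * k and T <= k, so the weight is at least 3 * k.\<close>
  then have "4 * k \<le> star_weight (n + 1) p + k"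
    using star_weight_eq[OF perm] transp_length_le[OF p(3)] by simp
  then show ?thesis
    using star_weight_le_diameter[OF perm] n by simp
qed

section \<open>The bijection from C_i to the smaller star graph\<close>

lemma bij_betw_star_C:
  fixes n i :: nat
  assumes "n \<ge> 1" and "2 \<le> i" and "i \<le> n + 1"
  defines "\<Phi> \<equiv> \<lambda>p. transpose i (n + 1) \<circ> (p \<circ> transpose 1 i) \<circ> transpose i (n + 1)"
  shows "bij_betw \<Phi> {p. p permutes {1..n + 1} \<and> p 1 = i} {q. q permutes {1..n}}"
proof (rule bij_betw_byWitness)
  let ?g = "transpose i (n + 1)"
  \<comment> \<open>\<open>\<Phi>\<close> sends \<open>i\<close> home and then renames the resulting
    fixed point \<open>i\<close> to \<open>n + 1\<close>; for \<open>i = n + 1\<close> the renaming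
    is the identity. \<open>\<Psi>\<close> undoes this in reverse order.\<close>
  define \<Psi> where "\<Psi> q = ?g \<circ> q \<circ> ?g \<circ> transpose 1 i" for q
  show "\<forall>p\<in>{p. p permutes {1..n + 1} \<and> p 1 = i}. \<Psi> (\<Phi> p) = p"
    by (simp add: \<Phi>_def \<Psi>_def fun_eq_iff)
  show "\<forall>q\<in>{q. q permutes {1..n}}. \<Phi> (\<Psi> q) = q"
    by (simp add: \<Phi>_def \<Psi>_def fun_eq_iff)
  have g: "?g permutes {1..n + 1}" "transpose 1 i permutes {1..n + 1}"
    using assms(2,3) by (auto intro!: permutes_swap_id)
  have "\<Phi> p permutes {1..n}" if p: "p permutes {1..n + 1}" "p 1 = i" for p
  proof (rule permutes_superset)
    show "\<Phi> p permutes {1..n + 1}"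
      unfolding \<Phi>_def by (intro permutes_compose g p)
    show "\<Phi> p x = x" if "x \<in> {1..n + 1} - {1..n}" for x
    proof -
      have "x = n + 1" using that by auto
      then show ?thesis using p(2) by (simp add: \<Phi>_def)
    qed
  qed
  then show "\<Phi> ` {p. p permutes {1..n + 1} \<and> p 1 = i} \<subseteq> {q. q permutes {1..n}}"
    by blast
  have "\<Psi> q permutes {1..n + 1} \<and> \<Psi> q 1 = i" if q: "q permutes {1..n}" for q
  proof
    have "q permutes {1..n + 1}"
      using q by (rule permutes_subset) auto
    then show "\<Psi> q permutes {1..n + 1}"
      unfolding \<Psi>_def by (intro permutes_compose g)
    \<comment> \<open>Under \<open>\<Psi> q\<close>, the point \<open>1\<close> goes to
      \<open>i\<close>, then \<open>n + 1\<close>, which \<open>q\<close> fixes, and back to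
      \<open>i\<close>.\<close>
    have "q (n + 1) = n + 1"
      using q by (rule permutes_not_in) simp
    then show "\<Psi> q 1 = i"
      by (simp add: \<Psi>_def)
  qed
  then show "\<Psi> ` {q. q permutes {1..n}} \<subseteq> {p. p permutes {1..n + 1} \<and> p 1 = i}"
    by blast
qed

lemma bij_betw_star_VC:
  assumes "n \<ge> 1" and "2 \<le> i" and "i \<le> n + 1"
  defines "\<Phi> \<equiv> \<lambda>p. transpose i (n + 1) \<circ> (p \<circ> transpose 1 i) \<circ> transpose i (n + 1)"
  shows "bij_betw \<Phi> (star_VC (n + 1) i (Suc \<omega>)) (star_V n \<omega>)"
proof -
  let ?C = "{p. p permutes {1..n + 1} \<and> p 1 = i}"
  have bij: "bij_betw \<Phi> ?C {q. q permutes {1..n}}"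
    unfolding \<Phi>_def by (rule bij_betw_star_C[OF assms(1-3)])
  have weight: "star_weight (n + 1) p = Suc (star_weight n (\<Phi> p))" if p: "p \<in> ?C" for p
  proof -
    have i: "i \<in> {2..n + 1}" using assms(2,3) by simp
    have "p \<circ> transpose 1 i permutes {1..n + 1}"
      using p i by (intro star_permutes_step) simp_all
    moreover have "\<Phi> p permutes {1..n}"
      using bij_betwE[OF bij] p by blast
    \<comment> \<open>The renaming keeps the weight, since \<open>i\<close> and \<open>n + 1\<close>
      both differ from \<open>1\<close>; the drop by one comes from sending \<open>i\<close>
      home.\<close>
    ultimately have "star_weight n (\<Phi> p) = star_weight (n + 1) (p \<circ> transpose 1 i)"
      unfolding \<Phi>_def using assms(1,2) by (intro star_weight_conj) auto
    then show ?thesis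
      using star_weight_comp_home[of p "n + 1" i] p i by simp
  qed
  have "star_VC (n + 1) i (Suc \<omega>) = {p \<in> ?C. star_weight n (\<Phi> p) = \<omega>}"
    using weight by (auto simp: star_VC_def star_C_def star_graph_def)
  moreover have "star_V n \<omega> = \<Phi> ` {p \<in> ?C. star_weight n (\<Phi> p) = \<omega>}"
    using bij_betw_imp_surj_on[OF bij] by (auto simp: star_V_def star_graph_def)
  ultimately show ?thesis
    using bij_betw_subset[OF bij] by (simp add: subset_eq)
qed

theorem theorem8:
  fixes n i :: nat
  assumes "n \<ge> 1" and "2 \<le> i" and "i \<le> n + 1"
  shows "card (star_VC (n + 1) i 0) = 0 \<and>
    (\<forall>\<omega>::nat. 1 \<le> \<omega> \<and> \<omega> \<le> 2 * (star_diameter (n + 1) div 2) \<longrightarrow>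
       card (star_VC (n + 1) i \<omega>) = card (star_V n (\<omega> - 1))) \<and>
    (even n \<longrightarrow> card (star_VC (n + 1) i (star_diameter (n + 1))) = 0)"
proof (intro conjI allI impI)
  \<comment> \<open>In this generality it also serves the third claim, at the diameter.\<close>
  have card_eq: "card (star_VC (n + 1) i \<omega>) = card (star_V n (\<omega> - 1))" if "\<omega> \<ge> 1" for \<omega>
    using bij_betw_same_card[OF bij_betw_star_VC[OF assms, of "\<omega> - 1"]] that by simp
  have "star_weight (n + 1) p \<noteq> 0" if "p permutes {1..n + 1}" "p 1 = i" for p
    using star_weight_comp_home[OF that] assms by simp
  then have "star_VC (n + 1) i 0 = {}"
    by (auto simp: star_VC_def star_C_def star_graph_def)
  then show "card (star_VC (n + 1) i 0) = 0"
    by simp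
  show "card (star_VC (n + 1) i \<omega>) = card (star_V n (\<omega> - 1))"
    if "1 \<le> \<omega> \<and> \<omega> \<le> 2 * (star_diameter (n + 1) div 2)" for \<omega>
    using card_eq that by blast
  show "card (star_VC (n + 1) i (star_diameter (n + 1))) = 0" if "even n"
  proof -
    have D: "3 * n \<le> 2 * star_diameter (n + 1)"
      using that by (rule star_diameter_ge)
    \<comment> \<open>Twice the weight is at most 3 * n - 3, while twice the diameter minus 2 is at
      least 3 * n - 2.\<close>
    have "star_weight n p \<noteq> star_diameter (n + 1) - 1" if "p permutes {1..n}" for p
      using star_weight_le[OF that assms(1)] D assms(1) by linarith
    then have "star_V n (star_diameter (n + 1) - 1) = {}"
      by (auto simp: star_V_def star_graph_def)
    moreover have "star_diameter (n + 1) \<ge> 1"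
      using D assms(1) by linarith
    ultimately show ?thesis
      using card_eq by simp
  qed
qed

end
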